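(* Let $Q$ be an IPC formula. Every theorem of the axiom system $\mathbb{U}_Q$ is a theorem of IPC.
   Context: The Implicational Propositional Calculus (IPC) has formulas built from propositional variables using only $\supset$, the single inference rule modus ponens, and the axiom schemes $X \supset (Y \supset X)$, $[X \supset (Y \supset Z)] \supset [(X \supset Y) \supset (X \supset Z)]$ and $[(X \supset Y) \supset X] \supset X$. For an IPC formula $Z$ write $QZ := Z \supset Q$. For a sequence $\theta = (Z_N, \dots, Z_0)$ of IPC formulas, $\mathcal{D}(\theta) := Z_N \supset (Z_{N-1} \supset ( \cdots (Z_0 \supset Q) \cdots ))$, and $(W,\theta)$ denotes $(W, Z_N, \dots, Z_0)$, so $\mathcal{D}(W,\theta) = W \supset \mathcal{D}(\theta)$. In what follows $\theta$ ranges over finite sequences of IPC formulas each of the form $QW$ or $QQW$ for some IPC formula $W$; such $\theta$ is closed if for some $W$ both $QW$ and $QQW$ are terms of $\theta$. A formula $\alpha = Q(X\supset Y)$ has $\alpha_0 = QQX$, $\alpha_1 = QY$; a formula $\beta = QQ(X \supset Y)$ has $\beta_0 = QX$, $\beta_1 = QQY$. The system $\mathbb{U}_Q$ has: axioms all formulas $\mathcal{D}(\theta)$ with $\theta$ closed; Rule A: if a formula $\alpha = Q(X\supset Y)$ is a term of $\theta$, then from $\mathcal{D}(\alpha_0,\theta)$ alone, or from $\mathcal{D}(\alpha_1,\theta)$ alone, infer $\mathcal{D}(\theta)$; Rule B: if a formula $\beta = QQ(X\supset Y)$ is a term of $\theta$, then from $\mathcal{D}(\beta_0,\theta)$ and $\mathcal{D}(\beta_1,\theta)$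 together infer $\mathcal{D}(\theta)$. The theorems of $\mathbb{U}_Q$ form the smallest set of formulas containing its axioms and closed under Rules A and B. *)

theory Defs
  imports Main
begin

datatype 'v fm = Var 'v | Imp "'v fm" "'v fm" (infixr "\<supset>" 60)

inductive ipc :: "'v fm \<Rightarrow> bool" where
  K: "ipc (X \<supset> (Y \<supset> X))"
| S: "ipc ((X \<supset> (Y \<supset> Z)) \<supset> ((X \<supset> Y) \<supset> (X \<supset> Z)))"
| Peirce: "ipc (((X \<supset> Y) \<supset> X) \<supset> X)"
| MP: "ipc (X \<supset> Y) \<Longrightarrow> ipc X \<Longrightarrow> ipc Y"

definition qneg :: "'v fm \<Rightarrow> 'v fm \<Rightarrow> 'v fm" where
  "qneg Q Z = Z \<supset> Q"

text \<open>A sequence \<open>(Z\<^sub>N, \<dots>, Z\<^sub>0)\<close> is the list \<open>[Z\<^sub>N, \<dots>, Z\<^sub>0]\<close>, so \<open>(W, \<theta>)\<close> is \<open>W # \<theta>\<close>.\<close>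

definition D :: "'v fm \<Rightarrow> 'v fm list \<Rightarrow> 'v fm" where
  "D Q \<theta> = foldr Imp \<theta> Q"

definition admissible :: "'v fm \<Rightarrow> 'v fm list \<Rightarrow> bool" where
  "admissible Q \<theta> \<longleftrightarrow>
     (\<forall>Z \<in> set \<theta>. (\<exists>W. Z = qneg Q W) \<or> (\<exists>W. Z = qneg Q (qneg Q W)))"

definition closed_seq :: "'v fm \<Rightarrow> 'v fm list \<Rightarrow> bool" where
  "closed_seq Q \<theta> \<longleftrightarrow> (\<exists>W. qneg Q W \<in> set \<theta> \<and> qneg Q (qneg Q W) \<in> set \<theta>)"

text \<open>
  The empty list needs no separate exclusion: it is not closed and has no terms, so it is never
  the \<open>\<theta>\<close> of an axiom or rule. The predicate is on formulas, not on sequences: a premise may have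
  been derived through a different sequence with the same value of \<open>D Q\<close>.
\<close>

inductive UQ :: "'v fm \<Rightarrow> 'v fm \<Rightarrow> bool" for Q :: "'v fm" where
  Ax: "admissible Q \<theta> \<Longrightarrow> closed_seq Q \<theta> \<Longrightarrow> UQ Q (D Q \<theta>)"
| A0: "admissible Q \<theta> \<Longrightarrow> qneg Q (X \<supset> Y) \<in> set \<theta> \<Longrightarrow>
       UQ Q (D Q (qneg Q (qneg Q X) # \<theta>)) \<Longrightarrow> UQ Q (D Q \<theta>)"
| A1: "admissible Q \<theta> \<Longrightarrow> qneg Q (X \<supset> Y) \<in> set \<theta> \<Longrightarrow>
       UQ Q (D Q (qneg Q Y # \<theta>)) \<Longrightarrow> UQ Q (D Q \<theta>)"
| B: "admissible Q \<theta> \<Longrightarrow> qneg Q (qneg Q (X \<supset> Y)) \<in> set \<theta> \<Longrightarrow>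
      UQ Q (D Q (qneg Q X # \<theta>)) \<Longrightarrow> UQ Q (D Q (qneg Q (qneg Q Y) # \<theta>)) \<Longrightarrow> UQ Q (D Q \<theta>)"

end

theory Submission
  imports Defs
begin

text \<open>
  By the deduction theorem \<open>D Q \<theta>\<close> is a theorem of IPC iff \<open>Q\<close> is derivable from the terms of \<open>\<theta>\<close>.
  Read this way, the axioms and Rules A (with \<open>\<alpha>\<^sub>1\<close>) and B of the system are positive-intuitionistic
  inferences. Rule A with \<open>\<alpha>\<^sub>0\<close> is classical: triple \<open>Q\<close>-negation reduces its premise to
  \<open>X \<supset> Q\<close>, so together with \<open>(X \<supset> Y) \<supset> Q\<close> one gets \<open>(Q \<supset> Y) \<supset> Q\<close>, and Peirce's law yields \<open>Q\<close>.
\<close>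

text \<open>Every theorem of IPC counts as a single step, so the deduction theorem has only three
  cases to treat. Hypotheses form a set, so order and repetition of terms cease to matter.\<close>

inductive derivable :: "'v fm set \<Rightarrow> 'v fm \<Rightarrow> bool" (infix "\<turnstile>" 50) for \<Gamma> :: "'v fm set" where
  hyp: "X \<in> \<Gamma> \<Longrightarrow> \<Gamma> \<turnstile> X"
| ipcI: "ipc X \<Longrightarrow> \<Gamma> \<turnstile> X"
| mp: "\<Gamma> \<turnstile> X \<supset> Y \<Longrightarrow> \<Gamma> \<turnstile> X \<Longrightarrow> \<Gamma> \<turnstile> Y"

lemma derivable_mono:
  assumes "\<Gamma> \<turnstile> X" and "\<Gamma> \<subseteq> \<Delta>"
  shows "\<Delta> \<turnstile> X"
  using assms
proof (induction rule: derivable.induct)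
  case (mp X Y)
  then show ?case
    by (metis derivable.mp)
qed (auto intro: hyp ipcI)

lemma derivable_empty_iff: "{} \<turnstile> X \<longleftrightarrow> ipc X"
proof
  show "ipc X" if "{} \<turnstile> X"
    using that
  proof (induction rule: derivable.induct)
    case (mp X Y)
    from mp.IH show ?case
      by (rule ipc.MP)
  qed auto
qed (rule ipcI)

lemma ipc_refl: "ipc (X \<supset> X)"
  \<comment> \<open>The combinator term S K K; the formula \<open>Y\<close> of the last
    \<open>K\<close> does not occur in the result, so taking it to be \<open>X\<close> is an
    arbitrary choice.\<close>
  using ipc.MP[OF ipc.MP[OF ipc.S ipc.K] ipc.K[where Y = X]] .

lemma deduction:
  assumes "insert X \<Gamma> \<turnstile> Y"
  shows "\<Gamma> \<turnstile> X \<supset> Y"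
  using assms
proof (induction rule: derivable.induct)
  case (hyp Y)
  then show ?case
    by (metis derivable.hyp insertE ipcI ipc.K ipc_refl mp)
next
  case (ipcI Y)
  then show ?case
    by (rule derivable.ipcI[OF ipc.MP[OF ipc.K]])
next
  case (mp Y Z)
  then show ?case
    by (metis derivable.mp derivable.ipcI ipc.S)
qed

lemma deduction_iff: "\<Gamma> \<turnstile> X \<supset> Y \<longleftrightarrow> insert X \<Gamma> \<turnstile> Y"
  by (meson deduction derivable_mono hyp insertI1 mp subset_insertI)

lemma ipc_D_iff: "ipc (D Q \<theta>) \<longleftrightarrow> set \<theta> \<turnstile> Q"
proof -
  \<comment> \<open>The induction moves the head of \<open>\<theta>\<close> into the context, hence
    the arbitrary \<open>\<Gamma>\<close>.\<close>
  have "\<Gamma> \<turnstile> D Q \<theta> \<longleftrightarrow> \<Gamma> \<union> set \<theta> \<turnstile> Q" for \<Gamma>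
    by (induction \<theta> arbitrary: \<Gamma>) (simp_all add: D_def deduction_iff)
  from this[of "{}"] show ?thesis
    by (simp add: derivable_empty_iff)
qed

lemma derivable_weaken: "\<Gamma> \<turnstile> X \<Longrightarrow> insert Y \<Gamma> \<turnstile> X"
  by (rule derivable_mono) auto

lemma qneg_qneg_intro:
  assumes "\<Gamma> \<turnstile> X"
  shows "\<Gamma> \<turnstile> qneg Q (qneg Q X)"
  unfolding qneg_def
  by (rule deduction, rule mp[of _ X]) (simp_all add: hyp derivable_weaken assms)

text \<open>Contraposition of \<open>qneg_qneg_intro\<close>: assuming \<open>X\<close> gives its
  double Q-negation, which the triple one sends to \<open>Q\<close>.\<close>

lemma qneg_triple:
  assumes "\<Gamma> \<turnstile> qneg Q (qneg Q (qneg Q X))"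
  shows "\<Gamma> \<turnstile> qneg Q X"
proof -
  have "insert X \<Gamma> \<turnstile> qneg Q (qneg Q X)"
    by (rule qneg_qneg_intro) (simp add: hyp)
  moreover have "insert X \<Gamma> \<turnstile> qneg Q (qneg Q X) \<supset> Q"
    using derivable_weaken[OF assms] by (simp add: qneg_def)
  ultimately have "insert X \<Gamma> \<turnstile> Q"
    by (rule mp[rotated])
  then show ?thesis
    unfolding qneg_def by (rule deduction)
qed

lemma derivable_alpha0:
  assumes "\<Gamma> \<turnstile> qneg Q (X \<supset> Y)" and "insert (qneg Q (qneg Q X)) \<Gamma> \<turnstile> Q"
  shows "\<Gamma> \<turnstile> Q"
proof -
  \<comment> \<open>Discharging the added hypothesis from the premise leaves exactly a triple
    Q-negation of \<open>X\<close>.\<close>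
  have "\<Gamma> \<turnstile> qneg Q X"
    by (rule qneg_triple) (use deduction[OF assms(2)] in \<open>simp add: qneg_def\<close>)
  \<comment> \<open>The extra assumption \<open>Q \<supset> Y\<close> is the inner antecedent of
    Peirce's law; composed with \<open>X \<supset> Q\<close> it gives
    \<open>X \<supset> Y\<close>.\<close>
  then have XQ: "insert X (insert (Q \<supset> Y) \<Gamma>) \<turnstile> X \<supset> Q"
    unfolding qneg_def by (intro derivable_weaken)
  have "insert X (insert (Q \<supset> Y) \<Gamma>) \<turnstile> Q"
    by (rule mp[OF XQ]) (simp add: hyp)
  then have "insert X (insert (Q \<supset> Y) \<Gamma>) \<turnstile> Y"
    by (rule mp[rotated]) (simp add: hyp)
  then have "insert (Q \<supset> Y) \<Gamma> \<turnstile> X \<supset> Y"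
    by (rule deduction)
  then have "insert (Q \<supset> Y) \<Gamma> \<turnstile> Q"
    using derivable_weaken[OF assms(1)] unfolding qneg_def by (rule mp[rotated])
  then have "\<Gamma> \<turnstile> (Q \<supset> Y) \<supset> Q"
    by (rule deduction)
  then show ?thesis
    by (rule mp[OF ipcI[OF ipc.Peirce]])
qed

text \<open>Contraposing the axiom \<open>Y \<supset> (X \<supset> Y)\<close> yields the hypothesis
  that the premise adds.\<close>

lemma derivable_alpha1:
  assumes "\<Gamma> \<turnstile> qneg Q (X \<supset> Y)" and "insert (qneg Q Y) \<Gamma> \<turnstile> Q"
  shows "\<Gamma> \<turnstile> Q"
proof -
  have "insert Y \<Gamma> \<turnstile> X \<supset> Y"
    by (rule mp[OF ipcI[OF ipc.K]]) (simp add: hyp)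
  then have "insert Y \<Gamma> \<turnstile> Q"
    using derivable_weaken[OF assms(1)] unfolding qneg_def by (rule mp[rotated])
  then have "\<Gamma> \<turnstile> qneg Q Y"
    unfolding qneg_def by (rule deduction)
  then show ?thesis
    by (rule mp[OF deduction[OF assms(2)]])
qed

text \<open>The second premise amounts to \<open>Y \<supset> Q\<close>. Under
  \<open>X \<supset> Y\<close> this gives \<open>X \<supset> Q\<close>, and the first premise then
  gives \<open>Q\<close>; so \<open>X \<supset> Y\<close> is Q-negated, against its double
  Q-negation.\<close>

lemma derivable_beta:
  assumes "\<Gamma> \<turnstile> qneg Q (qneg Q (X \<supset> Y))"
    and "insert (qneg Q X) \<Gamma> \<turnstile> Q" and "insert (qneg Q (qneg Q Y)) \<Gamma> \<turnstile> Q"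
  shows "\<Gamma> \<turnstile> Q"
proof -
  have QY: "\<Gamma> \<turnstile> qneg Q Y"
    by (rule qneg_triple) (use deduction[OF assms(3)] in \<open>simp add: qneg_def\<close>)
  let ?\<Delta> = "insert (X \<supset> Y) \<Gamma>"
  have "insert X ?\<Delta> \<turnstile> Y"
    by (rule mp[of _ X]) (simp_all add: hyp)
  moreover have "insert X ?\<Delta> \<turnstile> Y \<supset> Q"
    using QY unfolding qneg_def by (intro derivable_weaken)
  ultimately have "insert X ?\<Delta> \<turnstile> Q"
    by (rule mp[rotated])
  then have "?\<Delta> \<turnstile> qneg Q X"
    unfolding qneg_def by (rule deduction)
  then have "?\<Delta> \<turnstile> Q"
    by (rule mp[OF derivable_weaken[OF deduction[OF assms(2)]]])
  then have "\<Gamma> \<turnstile> qneg Q (X \<supset> Y)"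
    unfolding qneg_def by (rule deduction)
  then show ?thesis
    using assms(1) unfolding qneg_def by (rule mp[rotated])
qed

theorem theorem10:
  fixes Q Z :: "'v fm"
  assumes "UQ Q Z"
  shows "ipc Z"
  using assms
proof (induction rule: UQ.induct)
  case (Ax \<theta>)
  \<comment> \<open>The double Q-negation of \<open>W\<close> is itself an implication from
    \<open>qneg Q W\<close> to \<open>Q\<close>, so a closed sequence yields \<open>Q\<close> by one
    modus ponens.\<close>
  then obtain W where "set \<theta> \<turnstile> qneg Q W" and "set \<theta> \<turnstile> qneg Q W \<supset> Q"
    unfolding closed_seq_def by (auto simp: qneg_def intro: hyp)
  then show ?case
    unfolding ipc_D_iff by (rule mp[rotated])
next
  case (A0 \<theta> X Y)
  from A0.hyps(2) A0.IH show ?case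
    unfolding ipc_D_iff list.set by (rule derivable_alpha0[OF hyp])
next
  case (A1 \<theta> X Y)
  from A1.hyps(2) A1.IH show ?case
    unfolding ipc_D_iff list.set by (rule derivable_alpha1[OF hyp])
next
  case (B \<theta> X Y)
  from B.hyps(2) B.IH show ?case
    unfolding ipc_D_iff list.set by (rule derivable_beta[OF hyp])
qed

end
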